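(* Let $N = q^k n^2$ be an odd perfect number given in Eulerian form. Define $G = \gcd(\sigma(q^k),\sigma(n^2))$ and $I = \gcd(n,\sigma(n^2))$. Then the following conditions are equivalent: (1) $\sigma(q^k)/2$ divides $n$; (2) $n$ divides $\sigma(n^2)$; (3) $G = \sigma(q^k)/2$; (4) $I = n$.
   Context: $\sigma(x)$ denotes the sum of the positive divisors of $x$. A positive integer $N$ is perfect if $\sigma(N)=2N$. An odd perfect number $N$ is said to be given in Eulerian form $N = q^k n^2$ if $q$ is a prime (the special prime), $k$ and $n$ are positive integers, $q \equiv k \equiv 1 \pmod 4$, and $\gcd(q,n)=1$. *)

theory Defs
  imports "HOL-Number_Theory.Number_Theory"
begin

(* The argument 0 is outside the mathematical domain; there the sum ranges over an
   infinite set, so sigma 0 = 0. *)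
definition sigma :: "nat \<Rightarrow> nat" where
  "sigma x = (\<Sum>d | d dvd x. d)"

(* Positivity has to be required: sigma 0 = 2 * 0. *)
definition perfect :: "nat \<Rightarrow> bool" where
  "perfect N \<longleftrightarrow> N > 0 \<and> sigma N = 2 * N"

(* N = q^k * n^2 in Eulerian form with special prime q. *)
definition eulerian_form :: "nat \<Rightarrow> nat \<Rightarrow> nat \<Rightarrow> nat \<Rightarrow> bool" where
  "eulerian_form N q k n \<longleftrightarrow>
     N = q ^ k * n\<^sup>2 \<and> prime q \<and> k > 0 \<and> n > 0 \<and>
     [q = k] (mod 4) \<and> [k = 1] (mod 4) \<and> gcd q n = 1"

(* Under the Eulerian conditions sigma (q ^ k) is even, so that "sigma (q ^ k) div 2" is
   the exact quotient. *)
lemma even_sigma_special_prime_power: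
  assumes "prime q" "[q = k] (mod 4)" "[k = 1] (mod 4)"
  shows "even (sigma (q ^ k))"
proof -
  have "odd q" "odd k"
    using assms(2,3) by (auto simp: cong_def even_iff_mod_2_eq_zero) presburger+
  have "{d. d dvd q ^ k} = (\<lambda>i. q ^ i) ` {..k}"
    using divides_primepow_nat[OF assms(1)] by auto
  moreover have "inj_on (\<lambda>i. q ^ i) {..k}"
    using prime_gt_1_nat[OF assms(1)] by (auto simp: inj_on_def)
  ultimately have "sigma (q ^ k) = (\<Sum>i\<le>k. q ^ i)"
    by (simp add: sigma_def sum.reindex)
  also have "even \<dots>"
    using \<open>odd q\<close> \<open>odd k\<close> by (simp add: even_sum_iff)
  finally show ?thesis .
qed

end

theory Submission
  imports Defs
begin

text \<open>Put \<open>a = \<sigma>(q\<^sup>k) / 2\<close>. Since \<open>\<sigma>(q\<^sup>k) \<equiv> 1 (mod q)\<close>, the equation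
  \<open>a \<sigma>(n\<^sup>2) = q\<^sup>k n\<^sup>2\<close> gives \<open>\<sigma>(n\<^sup>2) = q\<^sup>k m\<close> with \<open>a m = n\<^sup>2\<close>. As \<open>\<sigma>(n\<^sup>2)\<close> is odd and
  \<open>a\<close> and \<open>n\<close> are coprime to \<open>q\<close>, the conditions become \<open>a | n\<close>, \<open>n | m\<close> and \<open>a | m\<close>, and the last
  one is equivalent to \<open>a\<^sup>2 | n\<^sup>2\<close>.\<close>

text \<open>Multiplication maps pairs of divisors of \<open>a\<close> and \<open>b\<close> onto the
  divisors of \<open>a * b\<close>. Coprimality makes this map injective, so the divisor sum of
  \<open>a * b\<close> runs over a product set and factors.\<close>

lemma sigma_mult_coprime:
  assumes "coprime a b"
  shows "sigma (a * b) = sigma a * sigma b"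
proof -
  have inj: "inj_on (\<lambda>(x, y). x * y) ({d. d dvd a} \<times> {d. d dvd b})"
  proof (rule inj_onI, clarify)
    fix x y x' y'
    assume dvd: "x dvd a" "y dvd b" "x' dvd a" "y' dvd b" and eq: "x * y = x' * y'"
    have "coprime x y'" "coprime x' y"
      using assms dvd coprime_divisors by blast+
    then have "x dvd x'" "x' dvd x"
      using eq by (metis coprime_dvd_mult_left_iff dvd_triv_left)+
    then have "x = x'" by (rule dvd_antisym)
    have "coprime y x'" "coprime y' x"
      using \<open>coprime x y'\<close> \<open>coprime x' y\<close> by (simp_all add: coprime_commute)
    then have "y dvd y'" "y' dvd y"
      using eq by (metis coprime_dvd_mult_right_iff dvd_triv_right)+
    with \<open>x = x'\<close> show "x = x' \<and> y = y'" by (simp add: dvd_antisym)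
  qed
  have "(\<lambda>(x, y). x * y) ` ({d. d dvd a} \<times> {d. d dvd b}) = {d. d dvd a * b}"
    by (auto simp: image_iff mult_dvd_mono dest: division_decomp)
  then have "sigma (a * b) = (\<Sum>(x, y)\<in>{d. d dvd a} \<times> {d. d dvd b}. x * y)"
    unfolding sigma_def using sum.reindex[OF inj, of "\<lambda>d. d"] by (simp add: case_prod_unfold)
  then show ?thesis
    by (simp add: sigma_def sum_product sum.cartesian_product)
qed

text \<open>All terms of the geometric sum except the first are multiples of \<open>q\<close>, so a
  common divisor of \<open>q\<close> and the sum divides 1.\<close>

lemma coprime_sigma_prime_power:
  assumes "prime q"
  shows "coprime q (sigma (q ^ k))"
proof -
  have "{d. d dvd q ^ k} = (\<lambda>i. q ^ i) ` {..k}"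
    using divides_primepow_nat[OF assms] by auto
  moreover have "inj_on (\<lambda>i. q ^ i) {..k}"
    using prime_gt_1_nat[OF assms] by (auto simp: inj_on_def)
  ultimately have "sigma (q ^ k) = (\<Sum>i\<le>k. q ^ i)"
    by (simp add: sigma_def sum.reindex)
  also have "\<dots> = 1 + q * (\<Sum>i<k. q ^ i)"
    by (simp add: sum.atMost_shift sum_distrib_left)
  finally have "sigma (q ^ k) = 1 + q * (\<Sum>i<k. q ^ i)" .
  then show ?thesis
    by (metis coprimeI dvd_add_left_iff dvd_mult2)
qed

theorem theorem2:
  fixes N q k n G I :: nat
  assumes "odd N" and "perfect N"
    and "eulerian_form N q k n"
    and "G = gcd (sigma (q ^ k)) (sigma (n\<^sup>2))"
    and "I = gcd n (sigma (n\<^sup>2))"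
  shows "(sigma (q ^ k) div 2 dvd n \<longleftrightarrow> n dvd sigma (n\<^sup>2)) \<and>
         (n dvd sigma (n\<^sup>2) \<longleftrightarrow> G = sigma (q ^ k) div 2) \<and>
         (G = sigma (q ^ k) div 2 \<longleftrightarrow> I = n)"
proof -
  have N: "N = q ^ k * n\<^sup>2" and q: "prime q" and "n > 0"
    and qk: "[q = k] (mod 4)" "[k = 1] (mod 4)" and qn: "coprime q n"
    using assms(3) unfolding eulerian_form_def coprime_iff_gcd_eq_1 by blast+
  define a where "a = sigma (q ^ k) div 2"
  have a: "sigma (q ^ k) = 2 * a"
    using even_sigma_special_prime_power[OF q qk] by (simp add: a_def)
  have "sigma (q ^ k) * sigma (n\<^sup>2) = 2 * N"
    using assms(2) qn N by (simp add: perfect_def flip: sigma_mult_coprime)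
  then have aB: "a * sigma (n\<^sup>2) = q ^ k * n\<^sup>2"
    using a N by simp
  have qa: "coprime q a"
    using coprime_sigma_prime_power[OF q, of k] a by simp
  have "q ^ k dvd a * sigma (n\<^sup>2)"
    using aB by simp
  then obtain m where m: "sigma (n\<^sup>2) = q ^ k * m"
    using qa by (auto simp: coprime_dvd_mult_right_iff)
  have am: "a * m = n\<^sup>2"
    using aB m prime_gt_0_nat[OF q] by (simp add: mult.left_commute)
  have "a > 0"
    using am \<open>n > 0\<close> by (metis gr0I mult_0 power_not_zero)
  \<comment> \<open>This number divides the odd \<open>N\<close>, so the factor 2 of
    \<open>sigma (q ^ k)\<close> drops out of \<open>G\<close>. The factor \<open>q ^ k\<close> of
    \<open>sigma (n\<^sup>2)\<close> drops out too, being coprime to \<open>a\<close>.\<close>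
  have "odd (sigma (n\<^sup>2))"
    using assms(1) aB N by (metis even_mult_iff)
  then have "gcd (2 * a) (sigma (n\<^sup>2)) = gcd a (sigma (n\<^sup>2))"
    by (intro gcd_mult_left_left_cancel) auto
  moreover have "coprime a (q ^ k)"
    using qa by (simp add: coprime_commute)
  ultimately have G: "G = gcd a m"
    using assms(4) a m by (simp add: gcd_mult_right_left_cancel)
  have I: "I = n \<longleftrightarrow> n dvd sigma (n\<^sup>2)"
    using assms(5) by (simp flip: gcd_nat.absorb_iff1)
  have n_dvd: "n dvd sigma (n\<^sup>2) \<longleftrightarrow> n dvd m"
    using qn m by (simp add: coprime_dvd_mult_right_iff coprime_commute)
  \<comment> \<open>Multiplying by \<open>n\<close> allows \<open>n * n\<close> to be replaced by
    \<open>a * m\<close>, after which \<open>a\<close> cancels.\<close>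
  have "a dvd n \<longleftrightarrow> a * n dvd n * n"
    using \<open>n > 0\<close> by simp
  also have "\<dots> \<longleftrightarrow> n dvd m"
    using am \<open>a > 0\<close> by (metis nat_mult_dvd_cancel1 power2_eq_square)
  finally have 1: "a dvd n \<longleftrightarrow> n dvd m" .
  \<comment> \<open>Multiplying by \<open>a\<close> turns the right side into the square of
    \<open>n\<close>; divisibility between squares is divisibility between their roots.\<close>
  have "a dvd m \<longleftrightarrow> a * a dvd a * m"
    using \<open>a > 0\<close> by simp
  also have "\<dots> \<longleftrightarrow> a dvd n"
    unfolding am by (simp flip: power2_eq_square)
  finally have 2: "G = a \<longleftrightarrow> a dvd n"
    using G by (simp flip: gcd_nat.absorb_iff1)
  show ?thesis
    using 1 2 I n_dvd by (auto simp flip: a_def)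
qed

end
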